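(* Fix an equivariant map $r:\mathcal X_*\to G$ (that is, $r(gx)=g\,r(x)$ for all $g\in G$, $x\in\mathcal X_*$) and a map $s:\mathcal Z\to G$, and let $x$ be distributed on $\mathcal X_*$ according to $p(x\mid [h],[g];f)\,\lambda(dx)$, where $([h],[g])\in H/H_0\times G/G_0$ is arbitrary. Suppose a statistic $t=t(x)$, $x\in\mathcal X_*$, is invariant under the action of $H$ as well as under the action of $G$, i.e. $t(gx)=t(x)$ for all $g\in G$, $x\in\mathcal X_*$, and $t(hx)=t(x)$ for all $h\in H$ and $x\in\mathcal X_*$ (with $hx\in\mathcal X_*$, which for each $h$ holds for $\lambda$-almost every $x$). Then the distribution of $t$ does not depend on $f$.
   Context: Spaces and groups. A group $H$ acts on a space $\mathcal X$ to the left, $(h,x)\mapsto hx$, and another group $G$ acts on a subspace $\mathcal X_*\subseteq\mathcal X$ to the left, $(g,x)\mapsto gx$. $\mathcal X$ and $\mathcal X_*$ are locally compact Hausdorff spaces; $H$ and $G$ are second countable, locally compact Hausdorff topological groups; both actions are continuous. Orbital decomposition. $r:\mathcal X_*\to G$ satisfies $r(gx)=g\,r(x)$ for $g\in G$, $x\in\mathcal X_*$. Put $z(x):=\{r(x)\}^{-1}x$ for $x\in\mathcal X_*$ and $\mathcal Z:=\{z(x):x\in\mathcal X_*\}$. Then every $x\in\mathcal X_*$ is uniquely written $x=gz$ with $g\in G$, $z\in\mathcal Z$ (namely $g=r(x)$, $z=z(x)$), so $\mathcal X_*$ is in one-to-one correspondence with $G\times\mathcal Z$. Dominating measure. $\lambda$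 is a measure on $\mathcal X$, relatively invariant under $H$ with multiplier $\chi_H$: $\lambda(d(hx))=\chi_H(h)\lambda(dx)$, $h\in H$. Its restriction to $\mathcal X_*$ is relatively invariant under $G$ with multiplier $\chi_G$: $\lambda(d(gx))=\chi_G(g)\lambda(dx)$, $g\in G$. (Multipliers are continuous homomorphisms into the multiplicative group of positive reals.) It is assumed that $\lambda(\mathcal X\setminus h\mathcal X_* )=0$ for each $h\in H$, where $h\mathcal X_*=\{hx:x\in\mathcal X_*\}$; hence expressions involving $r(h^{-1}x)$ or $z(h^{-1}x)$ are defined for $\lambda$-almost every $x$. $\mu_G$ is a left invariant measure on $G$ (unique up to a multiplicative constant). It is assumed that there is a measure $\nu_{\mathcal Z}$ on $\mathcal Z$ such that $\lambda=\chi_G\mu_G\otimes\nu_{\mathcal Z}$ under the correspondence $\mathcal X_*\ni x\leftrightarrow (r(x),z(x))\in G\times\mathcal Z$; the measure $\nu_{\mathcal Z}$ does not depend on $f$. Sampling model. Given $s:\mathcal Z\to G$ and $f:G\to\mathbb R_{\ge 0}$ with $\int_{\mathcal X_*} f(r(x)s(z(x)))\,\lambda(dx)=1$, for $h\in H$, $g\in G$ define the density with respect to $\lambda$ on $\mathcal X_*$ $$p(x\mid h,g;f)=\frac{1}{\chi_H(h)\chi_G(g)}\,f\big(g^{-1}r(h^{-1}x)\,s(z(h^{-1}x))\big).$$ It is assumed that there are compact subgroups $H_0\subseteq H$ and $G_0\subseteq G$ such that $f(g_0g)=f(g)$ for all $g\in G$, $g_0\in G_0$, and $r(h_0x)=r(x)$,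 $s(z(h_0x))=s(z(x))$ for all $x\in\mathcal X_*$, $h_0\in H_0$ (up to $\lambda$-null sets where $h_0x\notin\mathcal X_*$). Write $[h]=hH_0$, $[g]=gG_0$ for left cosets; then $p(\cdot\mid h,g;f)$ depends on $(h,g)$ only through $([h],[g])$ and is also written $p(\cdot\mid[h],[g];f)$. Only those $f$ are considered for which $p(\cdot\mid[h],[g];f)$ and $p(\cdot\mid[h'],[g'];f)$ give the same distribution if and only if $([h],[g])=([h'],[g'])$. "Does not depend on $f$" means: is the same for all such $f$, with the remaining data (spaces, groups, actions, $\lambda$, $r$, $s$, $H_0$, $G_0$, and the parameter $([h],[g])$) fixed. All maps, including $t$, are measurable (the correspondence $\mathcal X_*\leftrightarrow G\times\mathcal Z$ in both directions) and all measures are $\sigma$-finite. *)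

theory Defs
  imports "HOL-Analysis.Analysis" "HOL-Library.Set_Algebras"
begin

text \<open>
  The groups are types of class \<^class>\<open>topological_group_add\<close>, the library's class of topological
  groups. It does not require commutativity: \<open>a + b\<close>, \<open>- a\<close> and \<open>0\<close> are the product, the inverse
  and the unit of a possibly non-abelian group, and \<open>a +o A\<close> is the left translate
  (for a subgroup: the left coset) \<open>a A\<close>.
\<close>

definition is_subgroup :: "'a::group_add set \<Rightarrow> bool" where
  "is_subgroup K \<longleftrightarrow> 0 \<in> K \<and> (\<forall>a\<in>K. \<forall>b\<in>K. a + b \<in> K) \<and> (\<forall>a\<in>K. - a \<in> K)"

definition continuous_left_action ::
    "('a::topological_group_add \<Rightarrow> 'x::topological_space \<Rightarrow> 'x) \<Rightarrow> 'x set \<Rightarrow> bool" where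
  "continuous_left_action act S \<longleftrightarrow>
     (\<forall>a. \<forall>x\<in>S. act a x \<in> S) \<and>
     (\<forall>x\<in>S. act 0 x = x) \<and>
     (\<forall>a b. \<forall>x\<in>S. act (a + b) x = act a (act b x)) \<and>
     continuous_on (UNIV \<times> S) (\<lambda>(a, x). act a x)"

definition multiplier :: "('a::topological_group_add \<Rightarrow> real) \<Rightarrow> bool" where
  "multiplier c \<longleftrightarrow>
     continuous_on UNIV c \<and> (\<forall>a. 0 < c a) \<and> (\<forall>a b. c (a + b) = c a * c b)"

text \<open>The orbital part \<open>z(x) = r(x)\<inverse> x\<close>.\<close>

definition orbit_part :: "('g::group_add \<Rightarrow> 'x \<Rightarrow> 'x) \<Rightarrow> ('x \<Rightarrow> 'g) \<Rightarrow> 'x \<Rightarrow> 'x" where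
  "orbit_part actG r x = actG (- r x) x"

text \<open>
  The spaces \<open>Xs\<close> and \<open>Z = orbit_part actG r ` Xs\<close> are subsets of the type \<open>'x\<close> and carry the trace of
  the Borel sigma-algebra; \<open>r\<close>, \<open>s\<close> and \<open>actG\<close> matter only on \<open>Xs\<close>, \<open>Z\<close> and \<open>UNIV \<times> Xs\<close>.
  Since \<open>Xs\<close> is locally compact in a Hausdorff space, it is locally closed and so all
  its translates are Borel sets; membership in \<^const>\<open>null_sets\<close> below therefore says only that
  the measure is 0.
\<close>

locale orbital_model =
  fixes actH :: "'h::{topological_group_add, t2_space, second_countable_topology} \<Rightarrow> 'x::t2_space \<Rightarrow> 'x"
    and actG :: "'g::{topological_group_add, t2_space, second_countable_topology} \<Rightarrow> 'x \<Rightarrow> 'x"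
    and Xs :: "'x set"
    and lam :: "'x measure"
    and chiH :: "'h \<Rightarrow> real"
    and chiG :: "'g \<Rightarrow> real"
    and r :: "'x \<Rightarrow> 'g"
    and s :: "'x \<Rightarrow> 'g"
    and muG :: "'g measure"
    and nuZ :: "'x measure"
    and H0 :: "'h set"
    and G0 :: "'g set"
  assumes locally_compact_X: "locally_compact_space (euclidean :: 'x topology)"
    and locally_compact_Xs: "locally_compact_space (top_of_set Xs)"
    and locally_compact_H: "locally_compact_space (euclidean :: 'h topology)"
    and locally_compact_G: "locally_compact_space (euclidean :: 'g topology)"
    and action_H: "continuous_left_action actH UNIV"
    and action_G: "continuous_left_action actG Xs"
    and equivariant_r: "\<And>g x. x \<in> Xs \<Longrightarrow> r (actG g x) = g + r x"
    and measurable_decomposition: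
      "(\<lambda>x. (r x, orbit_part actG r x)) \<in>
         restrict_space borel Xs \<rightarrow>\<^sub>M borel \<Otimes>\<^sub>M restrict_space borel (orbit_part actG r ` Xs)"
    and measurable_composition:
      "(\<lambda>(g, z). actG g z) \<in>
         borel \<Otimes>\<^sub>M restrict_space borel (orbit_part actG r ` Xs) \<rightarrow>\<^sub>M restrict_space borel Xs"
    and measurable_s: "s \<in> restrict_space borel (orbit_part actG r ` Xs) \<rightarrow>\<^sub>M borel"
    and multiplier_H: "multiplier chiH"
    and multiplier_G: "multiplier chiG"
    and sets_lam: "sets lam = sets borel"
    and sigma_finite_lam: "sigma_finite_measure lam"
    and relatively_invariant_H:
      "\<And>h A. A \<in> sets borel \<Longrightarrow> emeasure lam (actH h ` A) = ennreal (chiH h) * emeasure lam A"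
    and relatively_invariant_G:
      "\<And>g A. A \<in> sets borel \<Longrightarrow> A \<subseteq> Xs \<Longrightarrow>
         emeasure lam (actG g ` A) = ennreal (chiG g) * emeasure lam A"
    and null_translates: "\<And>h. - (actH h ` Xs) \<in> null_sets lam"
    and sets_muG: "sets muG = sets borel"
    and sigma_finite_muG: "sigma_finite_measure muG"
    and left_invariant_muG: "\<And>g A. A \<in> sets borel \<Longrightarrow> emeasure muG (g +o A) = emeasure muG A"
    and sets_nuZ: "sets nuZ = sets (restrict_space borel (orbit_part actG r ` Xs))"
    and sigma_finite_nuZ: "sigma_finite_measure nuZ"
    and factorization_lam:
      "distr (restrict_space lam Xs) (borel \<Otimes>\<^sub>M restrict_space borel (orbit_part actG r ` Xs))
          (\<lambda>x. (r x, orbit_part actG r x))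
        = density muG (\<lambda>g. ennreal (chiG g)) \<Otimes>\<^sub>M nuZ"
    and subgroup_H0: "is_subgroup H0"
    and compact_H0: "compact H0"
    and subgroup_G0: "is_subgroup G0"
    and compact_G0: "compact G0"
    and r_H0: "\<And>h0 x. h0 \<in> H0 \<Longrightarrow> x \<in> Xs \<Longrightarrow> actH h0 x \<in> Xs \<Longrightarrow> r (actH h0 x) = r x"
    and s_H0: "\<And>h0 x. h0 \<in> H0 \<Longrightarrow> x \<in> Xs \<Longrightarrow> actH h0 x \<in> Xs \<Longrightarrow>
         s (orbit_part actG r (actH h0 x)) = s (orbit_part actG r x)"

text \<open>
  The density \<open>p(x | h, g; f)\<close>. The formula makes sense only where \<open>h\<inverse> x \<in> Xs\<close>, i.e. almost
  everywhere; on the exceptional null set we take the value 0, so that \<open>p\<close> is measurable.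
\<close>

definition sampling_pdf ::
    "('h::group_add \<Rightarrow> 'x \<Rightarrow> 'x) \<Rightarrow> ('g::group_add \<Rightarrow> 'x \<Rightarrow> 'x) \<Rightarrow> 'x set \<Rightarrow>
     ('h \<Rightarrow> real) \<Rightarrow> ('g \<Rightarrow> real) \<Rightarrow> ('x \<Rightarrow> 'g) \<Rightarrow> ('x \<Rightarrow> 'g) \<Rightarrow>
     ('g \<Rightarrow> real) \<Rightarrow> 'h \<Rightarrow> 'g \<Rightarrow> 'x \<Rightarrow> real" where
  "sampling_pdf actH actG Xs chiH chiG r s f h g x =
     (let y = actH (- h) x in
      if y \<in> Xs then 1 / (chiH h * chiG g) * f (- g + r y + s (orbit_part actG r y)) else 0)"

definition sampling_dist ::
    "('h::group_add \<Rightarrow> 'x \<Rightarrow> 'x) \<Rightarrow> ('g::group_add \<Rightarrow> 'x \<Rightarrow> 'x) \<Rightarrow> 'x set \<Rightarrow> 'x measure \<Rightarrow>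
     ('h \<Rightarrow> real) \<Rightarrow> ('g \<Rightarrow> real) \<Rightarrow> ('x \<Rightarrow> 'g) \<Rightarrow> ('x \<Rightarrow> 'g) \<Rightarrow>
     ('g \<Rightarrow> real) \<Rightarrow> 'h \<Rightarrow> 'g \<Rightarrow> 'x measure" where
  "sampling_dist actH actG Xs lam chiH chiG r s f h g =
     density (restrict_space lam Xs) (\<lambda>x. ennreal (sampling_pdf actH actG Xs chiH chiG r s f h g x))"

text \<open>
  The functions \<open>f\<close> under consideration; the last conjunct says that the distribution
  identifies the parameter \<open>(h H0, g G0)\<close>.
\<close>

definition admissible ::
    "('h::group_add \<Rightarrow> 'x \<Rightarrow> 'x) \<Rightarrow> ('g::{group_add, topological_space} \<Rightarrow> 'x \<Rightarrow> 'x) \<Rightarrow>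
     'x set \<Rightarrow> 'x measure \<Rightarrow> ('h \<Rightarrow> real) \<Rightarrow> ('g \<Rightarrow> real) \<Rightarrow> ('x \<Rightarrow> 'g) \<Rightarrow> ('x \<Rightarrow> 'g) \<Rightarrow>
     'h set \<Rightarrow> 'g set \<Rightarrow> ('g \<Rightarrow> real) \<Rightarrow> bool" where
  "admissible actH actG Xs lam chiH chiG r s H0 G0 f \<longleftrightarrow>
     f \<in> borel_measurable borel \<and>
     (\<forall>g. 0 \<le> f g) \<and>
     (\<integral>\<^sup>+x. ennreal (f (r x + s (orbit_part actG r x))) \<partial>restrict_space lam Xs) = 1 \<and>
     (\<forall>g0\<in>G0. \<forall>g. f (g0 + g) = f g) \<and>
     (\<forall>h g h' g'.
        sampling_dist actH actG Xs lam chiH chiG r s f h g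
          = sampling_dist actH actG Xs lam chiH chiG r s f h' g' \<longleftrightarrow>
        h +o H0 = h' +o H0 \<and> g +o G0 = g' +o G0)"

end

theory Submission
  imports Defs
begin

text \<open>
  In the coordinates \<open>(a, z) \<in> G \<times> Z\<close> the statistic is a function of \<open>z\<close> alone, and after moving the
  parameter to the unit the density is \<open>f (a s(z))\<close>. Integrating out \<open>a\<close> leaves the \<open>\<nu>\<^sub>Z\<close>-density
  \<open>k\<^sub>f (s(z))\<close>, where \<open>k\<^sub>f (c) = \<integral> f (a c) \<chi>\<^sub>G(a) \<mu>\<^sub>G(da)\<close>. As a right translate of \<open>\<mu>\<^sub>G\<close> is a multiple
  of \<open>\<mu>\<^sub>G\<close>, we have \<open>k\<^sub>f (c) = w(c) k\<^sub>f (1)\<close> with a factor \<open>w\<close> that does not involve \<open>f\<close>, and the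
  normalization of \<open>f\<close> then determines \<open>k\<^sub>f (1)\<close>.
\<close>

section \<open>Left invariant measures on a possibly non-abelian group\<close>

locale left_invariant_measure = sigma_finite_measure M
  for M :: "'g::{topological_group_add, second_countable_topology} measure" +
  assumes sets_M [measurable_cong, simp]: "sets M = sets borel"
    and emeasure_translate: "\<And>g A. A \<in> sets borel \<Longrightarrow> emeasure M (g +o A) = emeasure M A"

lemma measurable_uminus_group [measurable]:
  "uminus \<in> borel \<rightarrow>\<^sub>M (borel :: 'g::{topological_group_add, second_countable_topology} measure)"
  by (intro borel_measurable_continuous_onI continuous_intros)

lemma measurable_diff_group [measurable (raw)]:
  fixes f :: "'a \<Rightarrow> 'g::{topological_group_add, second_countable_topology}"
  assumes "f \<in> borel_measurable M" "g \<in> borel_measurable M"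
  shows "(\<lambda>x. f x - g x) \<in> borel_measurable M"
  using borel_measurable_continuous_Pair[OF assms, of "\<lambda>x y. x - y"]
  by (simp add: continuous_on_diff continuous_on_fst continuous_on_snd)

lemma elt_set_plus_eq_vimage:
  fixes g :: "'g::group_add"
  shows "g +o A = (+) (- g) -` A"
proof -
  have "x \<in> g +o A" if "- g + x \<in> A" for x
    unfolding elt_set_plus_def using that by (intro CollectI bexI[of _ "- g + x"]) (auto simp flip: add.assoc)
  then show ?thesis
    by (auto simp: elt_set_plus_def simp flip: add.assoc)
qed

context left_invariant_measure
begin

lemma space_M [simp]: "space M = UNIV"
  using sets_eq_imp_space_eq[OF sets_M] by simp

lemma distr_add_left: "distr M borel ((+) g) = M"
proof (rule measure_eqI)
  fix A assume "A \<in> sets (distr M borel ((+) g))"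
  then have A: "A \<in> sets borel" by simp
  then show "emeasure (distr M borel ((+) g)) A = emeasure M A"
    using emeasure_translate[OF A, of "- g"]
    by (subst emeasure_distr) (auto simp: elt_set_plus_eq_vimage)
qed simp

lemma nn_integral_add_left:
  assumes [measurable]: "f \<in> borel_measurable borel"
  shows "(\<integral>\<^sup>+x. f (g + x) \<partial>M) = (\<integral>\<^sup>+x. f x \<partial>M)"
proof -
  have "(\<integral>\<^sup>+x. f x \<partial>M) = (\<integral>\<^sup>+x. f x \<partial>distr M borel ((+) g))"
    by (simp add: distr_add_left)
  also have "\<dots> = (\<integral>\<^sup>+x. f (g + x) \<partial>M)"
    by (rule nn_integral_distr) auto
  finally show ?thesis by simp
qed

text \<open>Left and right translations commute, so left invariance survives a right translation.
  Sigma-finiteness transfers because translating back by \<open>- c\<close> recovers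
  \<open>M\<close>.\<close>

lemma left_invariant_measure_distr_add_right:
  "left_invariant_measure (distr M borel (\<lambda>x. x + c))"
proof -
  interpret D: sigma_finite_measure "distr M borel (\<lambda>x. x + c)"
  proof (rule sigma_finite_measure_distr)
    have "distr (distr M borel (\<lambda>x. x + c)) borel (\<lambda>x. x + - c) = distr M borel (\<lambda>x. x)"
      by (subst distr_distr; measurable) (simp_all add: comp_def)
    also have "\<dots> = M" by (simp add: distr_id2)
    finally show "sigma_finite_measure (distr (distr M borel (\<lambda>x. x + c)) borel (\<lambda>x. x + - c))"
      using sigma_finite_measure_axioms by simp
  qed auto
  show ?thesis
  proof
    fix g :: 'g and A :: "'g set" assume A: "A \<in> sets borel"
    have *: "(\<lambda>x. x + c) -` A \<in> sets borel"
      using measurable_sets[OF _ A, of "\<lambda>x. x + c" borel] by simp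
    have B: "g +o A \<in> sets borel"
      using measurable_sets[OF _ A, of "(+) (- g)" borel] by (simp add: elt_set_plus_eq_vimage)
    have "(\<lambda>x. x + c) -` (g +o A) = g +o ((\<lambda>x. x + c) -` A)"
      by (auto simp: elt_set_plus_eq_vimage add.assoc)
    then show "emeasure (distr M borel (\<lambda>x. x + c)) (g +o A) = emeasure (distr M borel (\<lambda>x. x + c)) A"
      using emeasure_translate[OF *, of g] A B by (simp add: emeasure_distr)
  qed auto
qed

end

section \<open>Uniqueness of left invariant measures up to a constant factor\<close>

text \<open>Integrate the indicator of \<open>- y + x\<close> lying in \<open>E\<close> in both
  orders. For fixed \<open>x\<close>, left invariance of \<open>N\<close> makes the integral over
  \<open>y\<close> the \<open>N\<close>-measure of the inverse of \<open>E\<close>; for fixed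
  \<open>y\<close>, left invariance of \<open>M\<close> makes the integral over \<open>x\<close> the
  \<open>M\<close>-measure of \<open>E\<close>, which is 0.\<close>

lemma left_invariant_null_uminus:
  assumes "left_invariant_measure M" "left_invariant_measure N"
    and "emeasure M UNIV \<noteq> 0" and E [measurable]: "E \<in> sets borel" and null: "emeasure M E = 0"
  shows "emeasure N (uminus -` E) = 0"
proof -
  interpret M: left_invariant_measure M by fact
  interpret N: left_invariant_measure N by fact
  interpret pair_sigma_finite M N ..
  have E': "uminus -` E \<in> sets borel"
    using measurable_sets[OF measurable_uminus_group E] by simp
  have "emeasure N (uminus -` E) * emeasure M UNIV
      = (\<integral>\<^sup>+x. \<integral>\<^sup>+y. indicator (uminus -` E) (- x + y) \<partial>N \<partial>M)"
    using E' by (subst N.nn_integral_add_left) auto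
  also have "\<dots> = (\<integral>\<^sup>+x. \<integral>\<^sup>+y. indicator E (- y + x) \<partial>N \<partial>M)"
    by (simp add: indicator_def minus_add)
  also have "\<dots> = (\<integral>\<^sup>+y. \<integral>\<^sup>+x. indicator E (- y + x) \<partial>M \<partial>N)"
    by (rule Fubini'[symmetric]) measurable
  also have "\<dots> = 0"
    using null by (subst M.nn_integral_add_left) auto
  finally show ?thesis using assms(3) by simp
qed

text \<open>Inversion is used twice, first with \<open>M\<close> in both roles and then from
  \<open>M\<close> to \<open>N\<close>, so that the set returns to \<open>E\<close>.\<close>

lemma left_invariant_absolutely_continuous:
  assumes "left_invariant_measure M" "left_invariant_measure N" "emeasure M UNIV \<noteq> 0"
  shows "absolutely_continuous M N"
  unfolding absolutely_continuous_def
proof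
  interpret M: left_invariant_measure M by fact
  interpret N: left_invariant_measure N by fact
  fix E assume "E \<in> null_sets M"
  then have E: "E \<in> sets borel" "emeasure M E = 0" by auto
  have E': "uminus -` E \<in> sets borel"
    using measurable_sets[OF measurable_uminus_group E(1)] by simp
  have "emeasure M (uminus -` E) = 0"
    using left_invariant_null_uminus[OF assms(1,1,3) E] .
  from left_invariant_null_uminus[OF assms E' this] have "emeasure N E = 0"
    by (simp add: vimage_def)
  with E show "E \<in> null_sets N" by auto
qed

text \<open>
  The density of \<open>N\<close> with respect to \<open>M\<close> agrees almost everywhere with each of its left translates;
  by Fubini one of its right translates is almost everywhere constant, hence so is the density.
\<close>

theorem left_invariant_measure_unique:
  assumes "left_invariant_measure M" "left_invariant_measure N" "emeasure M UNIV \<noteq> 0"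
  obtains c where "N = density M (\<lambda>_. c)"
proof -
  interpret M: left_invariant_measure M by fact
  interpret N: left_invariant_measure N by fact
  interpret pair_sigma_finite M M ..
  have "\<exists>D\<in>borel_measurable M. density M D = N"
    by (intro M.Radon_Nikodym left_invariant_absolutely_continuous assms) simp
  then obtain D where D [measurable]: "D \<in> borel_measurable borel" and N: "N = density M D"
    using measurable_cong_sets[OF M.sets_M refl] by blast
  \<comment> \<open>Both functions are densities of \<open>N\<close>: translating the variable by
    \<open>a\<close> turns \<open>A\<close> into \<open>a +o A\<close>, which has the same
    \<open>N\<close>-measure.\<close>
  have "AE x in M. D (a + x) = D x" for a
  proof (rule sigma_finite_density_unique[THEN iffD1])
    show "density M (\<lambda>x. D (a + x)) = density M D"
    proof (rule measure_eqI)
      fix A assume "A \<in> sets (density M (\<lambda>x. D (a + x)))"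
      then have A [measurable]: "A \<in> sets borel" by simp
      have [measurable]: "a +o A \<in> sets borel"
        using measurable_sets[OF _ A, of "(+) (- a)" borel] by (simp add: elt_set_plus_eq_vimage)
      have "emeasure (density M (\<lambda>x. D (a + x))) A = (\<integral>\<^sup>+x. D (a + x) * indicator A x \<partial>M)"
        by (rule emeasure_density) auto
      also have "\<dots> = (\<integral>\<^sup>+x. D (a + x) * indicator (a +o A) (a + x) \<partial>M)"
        by (simp add: elt_set_plus_eq_vimage indicator_def flip: add.assoc)
      also have "\<dots> = (\<integral>\<^sup>+x. D x * indicator (a +o A) x \<partial>M)"
        by (rule M.nn_integral_add_left) measurable
      also have "\<dots> = emeasure N (a +o A)"
        unfolding N by (rule emeasure_density[symmetric]) auto
      also have "\<dots> = emeasure (density M D) A"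
        using N.emeasure_translate[OF A] N by simp
      finally show "emeasure (density M (\<lambda>x. D (a + x))) A = emeasure (density M D) A" .
    qed simp
    then show "sigma_finite_measure (density M (\<lambda>x. D (a + x)))"
      using N N.sigma_finite_measure_axioms by simp
  qed auto
  then have "AE a in M. AE x in M. D (a + x) = D x" by simp
  then have "AE x in M. AE a in M. D (a + x) = D x"
    by (rule AE_commute[THEN iffD1, rotated]) measurable
  \<comment> \<open>As \<open>M\<close> is nonzero, a property that holds almost everywhere holds at
    some point \<open>x\<close>.\<close>
  moreover have "\<not> (AE x in M. False)"
    using assms(3) by (simp add: AE_iff_measurable[OF _ refl])
  ultimately obtain x where x: "AE a in M. D (a + x) = D x"
    by (metis (mono_tags, lifting) eventually_mono)
  \<comment> \<open>Under \<open>?R\<close> the choice of \<open>x\<close> says that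
    \<open>D\<close> equals \<open>D x\<close> almost everywhere. Since \<open>?R\<close> is itself
    left invariant and nonzero, its null sets are null for \<open>M\<close>, which carries the
    statement over.\<close>
  let ?R = "distr M borel (\<lambda>a. a + x)"
  interpret R: left_invariant_measure ?R
    by (rule M.left_invariant_measure_distr_add_right)
  have "emeasure ?R UNIV \<noteq> 0"
    using assms(3) by (simp add: emeasure_distr)
  then have "absolutely_continuous ?R M"
    by (intro left_invariant_absolutely_continuous assms R.left_invariant_measure_axioms)
  moreover have "AE y in ?R. D y = D x"
    using x by (subst AE_distr_iff) auto
  ultimately have "AE y in M. D y = D x"
    by (rule absolutely_continuous_AE[rotated]) simp
  then have "density M D = density M (\<lambda>_. D x)"
    by (intro density_cong) auto
  with N that show thesis by simp
qed

text \<open>Uniqueness applies to the image of \<open>M\<close> under right translation by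
  \<open>c\<close>. The factor \<open>d\<close> plays the part of the modular function at
  \<open>c\<close>; it is obtained before \<open>f\<close>, so one \<open>d\<close> serves all
  integrands.\<close>

lemma (in left_invariant_measure) nn_integral_add_right:
  obtains d where "\<And>f :: 'g \<Rightarrow> ennreal. f \<in> borel_measurable borel \<Longrightarrow>
    (\<integral>\<^sup>+x. f (x + c) \<partial>M) = d * (\<integral>\<^sup>+x. f x \<partial>M)"
proof (cases "emeasure M UNIV = 0")
  case True
  then have "M = null_measure M"
    by (intro measure_eqI) (auto intro: emeasure_eq_0[of UNIV])
  then have "(\<integral>\<^sup>+x. f x \<partial>M) = 0" for f
    using nn_integral_null_measure by metis
  then show thesis using that by simp
next
  case False
  then obtain d where d: "distr M borel (\<lambda>x. x + c) = density M (\<lambda>_. d)"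
    using left_invariant_measure_unique[OF left_invariant_measure_axioms left_invariant_measure_distr_add_right]
    by blast
  show thesis
  proof (rule that)
    fix f :: "'g \<Rightarrow> ennreal" assume [measurable]: "f \<in> borel_measurable borel"
    have "(\<integral>\<^sup>+x. f (x + c) \<partial>M) = (\<integral>\<^sup>+x. f x \<partial>distr M borel (\<lambda>x. x + c))"
      by (rule nn_integral_distr[symmetric]) auto
    also have "\<dots> = d * (\<integral>\<^sup>+x. f x \<partial>M)"
      unfolding d by (subst nn_integral_density) (auto simp: nn_integral_cmult)
    finally show "(\<integral>\<^sup>+x. f (x + c) \<partial>M) = d * (\<integral>\<^sup>+x. f x \<partial>M)" .
  qed
qed

section \<open>Changes of variables in the orbital model\<close>

context orbital_model
begin

abbreviation Z where "Z \<equiv> orbit_part actG r ` Xs"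

sublocale G: left_invariant_measure muG
  using sigma_finite_muG sets_muG left_invariant_muG
  by (simp add: left_invariant_measure_def left_invariant_measure_axioms_def)

sublocale nuZ: sigma_finite_measure nuZ
  by (rule sigma_finite_nuZ)

lemma sets_nuZ_cong [measurable_cong]: "sets nuZ = sets (restrict_space borel Z)"
  by (rule sets_nuZ)

lemma sets_lam_cong [measurable_cong]: "sets lam = sets borel"
  by (rule sets_lam)

lemma space_lam [simp]: "space lam = UNIV"
  using sets_eq_imp_space_eq[OF sets_lam] by simp

lemma space_nuZ: "space nuZ = Z"
  using sets_eq_imp_space_eq[OF sets_nuZ] by (simp add: space_restrict_space)

lemma actH_0 [simp]: "actH 0 x = x"
  and actH_add: "actH (a + b) x = actH a (actH b x)"
  using action_H by (auto simp: continuous_left_action_def)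

lemma actG_in_Xs: "x \<in> Xs \<Longrightarrow> actG a x \<in> Xs"
  using action_G by (auto simp: continuous_left_action_def)

lemma measurable_actH [measurable]: "actH a \<in> borel \<rightarrow>\<^sub>M borel"
proof (rule borel_measurable_continuous_onI)
  have "continuous_on UNIV ((\<lambda>(a, x). actH a x) \<circ> (\<lambda>x. (a, x)))"
    using action_H unfolding continuous_left_action_def
    by (intro continuous_on_compose continuous_intros) (auto elim: continuous_on_subset)
  then show "continuous_on UNIV (actH a)" by (simp add: comp_def)
qed

lemma actH_image_eq_vimage: "actH a ` A = actH (- a) -` A"
proof -
  have "x \<in> actH a ` A" if "actH (- a) x \<in> A" for x
    using that by (intro image_eqI[of _ _ "actH (- a) x"]) (simp_all flip: actH_add)
  then show ?thesis
    by (auto simp flip: actH_add)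
qed

text \<open>The complement of \<open>Xs\<close> is the null set given by
  \<open>null_translates\<close> at the unit, and null sets are measurable.\<close>

lemma Xs_borel [measurable]: "Xs \<in> sets borel"
proof -
  have "- Xs \<in> sets borel"
    using null_translates[of 0] sets_lam by (auto simp: null_sets_def)
  then have "UNIV - (- Xs) \<in> sets borel" by (intro sets.Diff) auto
  then show ?thesis by (simp add: Compl_eq_Diff_UNIV[symmetric])
qed

lemma AE_Xs: "AE x in lam. x \<in> Xs"
  by (rule AE_I'[OF null_translates[of 0]]) auto

lemma nn_integral_lam_Xs: "(\<integral>\<^sup>+x. F x \<partial>restrict_space lam Xs) = (\<integral>\<^sup>+x. F x * indicator Xs x \<partial>lam)"
  using Xs_borel sets_lam by (intro nn_integral_restrict_space) simp

lemma chiH_pos: "0 < chiH a" and chiG_pos: "0 < chiG b"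
  and chiG_add: "chiG (b + c) = chiG b * chiG c"
  using multiplier_H multiplier_G by (auto simp: multiplier_def)

lemma measurable_chiG [measurable]: "chiG \<in> borel_measurable borel"
  using multiplier_G by (auto simp: multiplier_def intro: borel_measurable_continuous_onI)

text \<open>Relative invariance speaks of images under \<open>a\<close>, which are preimages under
  \<open>- a\<close>; hence the factor is \<open>chiH a\<close> and not its inverse.\<close>

lemma distr_actH_uminus: "distr lam borel (actH (- a)) = density lam (\<lambda>_. ennreal (chiH a))"
proof (rule measure_eqI)
  fix A assume "A \<in> sets (distr lam borel (actH (- a)))"
  then have A: "A \<in> sets borel" by simp
  have [measurable]: "actH (- a) \<in> lam \<rightarrow>\<^sub>M borel"
    by measurable
  show "emeasure (distr lam borel (actH (- a))) A = emeasure (density lam (\<lambda>_. ennreal (chiH a))) A"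
    using relatively_invariant_H[OF A, of a] A sets_lam
    by (simp add: emeasure_distr emeasure_density actH_image_eq_vimage nn_integral_cmult_indicator)
qed (simp add: sets_lam)

lemma nn_integral_actH_uminus:
  assumes [measurable]: "F \<in> borel_measurable borel"
  shows "(\<integral>\<^sup>+x. F (actH (- a) x) \<partial>lam) = ennreal (chiH a) * (\<integral>\<^sup>+x. F x \<partial>lam)"
proof -
  have "(\<integral>\<^sup>+x. F (actH (- a) x) \<partial>lam) = (\<integral>\<^sup>+x. F x \<partial>distr lam borel (actH (- a)))"
    by (rule nn_integral_distr[symmetric]) measurable
  then show ?thesis
    unfolding distr_actH_uminus by (simp add: nn_integral_density nn_integral_cmult)
qed

lemma nn_integral_decomposition:
  assumes [measurable]: "F \<in> borel_measurable (borel \<Otimes>\<^sub>M restrict_space borel Z)"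
  shows "(\<integral>\<^sup>+x. F (r x, orbit_part actG r x) \<partial>restrict_space lam Xs)
       = (\<integral>\<^sup>+z. \<integral>\<^sup>+a. ennreal (chiG a) * F (a, z) \<partial>muG \<partial>nuZ)"
proof -
  let ?D = "density muG (\<lambda>g. ennreal (chiG g))"
  have [measurable_cong]: "sets (restrict_space lam Xs) = sets (restrict_space borel Xs)"
    by (rule sets_restrict_space_cong[OF sets_lam])
  note measurable_decomposition [measurable]
  \<comment> \<open>Fubini requires this of the weighted measure; it holds because
    \<open>chiG\<close> takes finite values.\<close>
  have "sigma_finite_measure ?D"
    by (subst G.sigma_finite_iff_density_finite) auto
  then interpret pair_sigma_finite ?D nuZ
    using sigma_finite_nuZ by (simp add: pair_sigma_finite_def)
  have "(\<integral>\<^sup>+x. F (r x, orbit_part actG r x) \<partial>restrict_space lam Xs)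
      = (\<integral>\<^sup>+p. F p \<partial>(?D \<Otimes>\<^sub>M nuZ))"
    unfolding factorization_lam[symmetric]
    by (subst nn_integral_distr) auto
  also have "\<dots> = (\<integral>\<^sup>+z. \<integral>\<^sup>+a. F (a, z) \<partial>?D \<partial>nuZ)"
    by (rule nn_integral_snd[symmetric]) measurable
  also have "\<dots> = (\<integral>\<^sup>+z. \<integral>\<^sup>+a. ennreal (chiG a) * F (a, z) \<partial>muG \<partial>nuZ)"
    by (intro nn_integral_cong nn_integral_density) (auto simp: space_nuZ space_restrict_space)
  finally show ?thesis .
qed

section \<open>Mass of the density along an orbit\<close>

text \<open>With both parameters at the unit, \<open>fibre_mass f (s z)\<close> is the
  \<open>nuZ\<close>-density of the orbital part at \<open>z\<close>. Values in
  \<open>ennreal\<close> allow computing with it before finiteness is known.\<close>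

definition fibre_mass :: "('g \<Rightarrow> real) \<Rightarrow> 'g \<Rightarrow> ennreal" where
  "fibre_mass f c = (\<integral>\<^sup>+a. ennreal (chiG a) * ennreal (f (a + c)) \<partial>muG)"

text \<open>Writing \<open>chiG a\<close> as \<open>chiG (a + c) / chiG c\<close> makes the
  integrand a right translate by \<open>c\<close>. Thus \<open>w\<close> is \<open>d\<close> divided
  by \<open>chiG c\<close>, and it is fixed before \<open>f\<close>.\<close>

lemma fibre_mass_eq:
  obtains w where "\<And>f. f \<in> borel_measurable borel \<Longrightarrow> fibre_mass f c = w * fibre_mass f 0"
proof -
  obtain d where d: "\<And>F. F \<in> borel_measurable borel \<Longrightarrow>
      (\<integral>\<^sup>+x. F (x + c) \<partial>muG) = d * (\<integral>\<^sup>+x. F x \<partial>muG)"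
    using G.nn_integral_add_right by blast
  show thesis
  proof (rule that)
    fix f :: "'g \<Rightarrow> real" assume [measurable]: "f \<in> borel_measurable borel"
    have chi: "ennreal (chiG a) = ennreal (1 / chiG c) * ennreal (chiG (a + c))" for a
      using chiG_pos[of c] chiG_pos[of a] by (simp add: chiG_add flip: ennreal_mult'')
    have "fibre_mass f c
        = (\<integral>\<^sup>+a. ennreal (1 / chiG c) * (ennreal (chiG (a + c)) * ennreal (f (a + c))) \<partial>muG)"
      unfolding fibre_mass_def by (intro nn_integral_cong) (metis chi mult.assoc)
    also have "\<dots> = ennreal (1 / chiG c) * (\<integral>\<^sup>+a. ennreal (chiG (a + c)) * ennreal (f (a + c)) \<partial>muG)"
      by (rule nn_integral_cmult) measurable
    also have "\<dots> = (ennreal (1 / chiG c) * d) * fibre_mass f 0"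
      unfolding fibre_mass_def by (subst d[of "\<lambda>x. ennreal (chiG x) * ennreal (f x)"]) (auto simp: mult.assoc)
    finally show "fibre_mass f c = (ennreal (1 / chiG c) * d) * fibre_mass f 0" .
  qed
qed

lemma measurable_fibre_mass [measurable]:
  assumes [measurable]: "f \<in> borel_measurable borel"
  shows "fibre_mass f \<in> borel_measurable borel"
  unfolding fibre_mass_def by measurable

text \<open>
  By the normalization \<open>fibre_mass f \<circ> s\<close> has integral 1; integrating the cross relation therefore
  gives equality at the unit, whether or not \<open>fibre_mass f 0\<close> is known to be finite and positive.
\<close>

lemma fibre_mass_unique:
  assumes f: "f \<in> borel_measurable borel"
      "(\<integral>\<^sup>+x. ennreal (f (r x + s (orbit_part actG r x))) \<partial>restrict_space lam Xs) = 1"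
    and f': "f' \<in> borel_measurable borel"
      "(\<integral>\<^sup>+x. ennreal (f' (r x + s (orbit_part actG r x))) \<partial>restrict_space lam Xs) = 1"
  shows "fibre_mass f = fibre_mass f'"
proof -
  note measurable_s [measurable]
  have mass: "(\<integral>\<^sup>+z. fibre_mass F (s z) \<partial>nuZ) = 1"
    if [measurable]: "F \<in> borel_measurable borel"
      and "(\<integral>\<^sup>+x. ennreal (F (r x + s (orbit_part actG r x))) \<partial>restrict_space lam Xs) = 1" for F
    using nn_integral_decomposition[of "\<lambda>(a, z). ennreal (F (a + s z))"] that(2)
    by (simp add: fibre_mass_def)
  note [measurable] = f(1) f'(1)
  \<comment> \<open>The common factor \<open>w\<close> is multiplied across instead of divided out,
    so the values 0 and infinity do no harm.\<close>
  have cross: "fibre_mass f c * fibre_mass f' 0 = fibre_mass f' c * fibre_mass f 0" for c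
  proof -
    obtain w where "\<And>F. F \<in> borel_measurable borel \<Longrightarrow> fibre_mass F c = w * fibre_mass F 0"
      using fibre_mass_eq by blast
    then show ?thesis by (simp add: ac_simps)
  qed
  have "fibre_mass f' 0 = (\<integral>\<^sup>+z. fibre_mass f (s z) * fibre_mass f' 0 \<partial>nuZ)"
    using mass[OF f] by (simp add: nn_integral_multc)
  also have "\<dots> = fibre_mass f 0"
    using mass[OF f'] by (simp add: cross nn_integral_multc)
  finally have eq: "fibre_mass f' 0 = fibre_mass f 0" .
  show ?thesis
  proof
    fix c
    obtain w where "\<And>F. F \<in> borel_measurable borel \<Longrightarrow> fibre_mass F c = w * fibre_mass F 0"
      using fibre_mass_eq by blast
    with eq show "fibre_mass f c = fibre_mass f' c" by simp
  qed
qed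

text \<open>
  Off the null sets where \<open>x\<close> or \<open>h\<inverse> x\<close> leaves \<^term>\<open>Xs\<close>, the statistic takes the same value at
  \<open>x\<close>, at \<open>h\<inverse> x\<close> and at the orbital part of the latter.
\<close>

lemma emeasure_distr_statistic:
  assumes t: "t \<in> restrict_space borel Xs \<rightarrow>\<^sub>M T"
    and t_G: "\<And>b x. x \<in> Xs \<Longrightarrow> t (actG b x) = t x"
    and t_H: "\<And>a x. x \<in> Xs \<Longrightarrow> actH a x \<in> Xs \<Longrightarrow> t (actH a x) = t x"
    and f [measurable]: "f \<in> borel_measurable borel" and f_nonneg: "\<And>a. 0 \<le> f a"
    and B [measurable]: "B \<in> sets T"
  shows "emeasure (distr (sampling_dist actH actG Xs lam chiH chiG r s f h g) T t) B
       = (\<integral>\<^sup>+z. indicator B (t z) * fibre_mass f (s z) \<partial>nuZ)"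
proof -
  let ?R = "restrict_space lam Xs"
  let ?z = "orbit_part actG r"
  let ?p = "sampling_pdf actH actG Xs chiH chiG r s f h g"
  note [measurable] = t measurable_s measurable_decomposition
  have sets_R [measurable_cong]: "sets ?R = sets (restrict_space borel Xs)"
    by (rule sets_restrict_space_cong[OF sets_lam])
  have z_in: "?z x \<in> Xs" if "x \<in> Xs" for x
    using that by (simp add: orbit_part_def actG_in_Xs)
  have [measurable]: "t \<in> restrict_space borel Z \<rightarrow>\<^sub>M T"
    using t z_in by (intro measurable_restrict_mono[OF t]) auto
  \<comment> \<open>The sampling density at \<open>x\<close>, expressed in the coordinates of
    \<open>actH (- h) x\<close>.\<close>
  define q where "q = (\<lambda>(a, z). ennreal (1 / (chiH h * chiG g) * f (- g + a + s z)))"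
  have [measurable]: "q \<in> borel_measurable (borel \<Otimes>\<^sub>M restrict_space borel Z)"
    unfolding q_def by measurable
  \<comment> \<open>Extension by 0 off \<open>Xs\<close> makes \<open>Q\<close> and
    \<open>QB\<close> Borel on the whole space, where the substitution by \<open>h\<close> takes
    place. In \<open>QB\<close> the statistic is evaluated at the orbital part.\<close>
  define Q where "Q x = q (r x, ?z x) * indicator Xs x" for x
  have Q [measurable]: "Q \<in> borel_measurable borel"
    unfolding Q_def by (subst borel_measurable_restrict_space_iff_ennreal[symmetric]) auto
  define QB where "QB x = indicator B (t (?z x)) * q (r x, ?z x) * indicator Xs x" for x
  have QB [measurable]: "QB \<in> borel_measurable borel"
    unfolding QB_def by (subst borel_measurable_restrict_space_iff_ennreal[symmetric]) auto
  have p: "ennreal (?p x) = Q (actH (- h) x)" for x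
    by (simp add: sampling_pdf_def Q_def q_def Let_def)
  have p_meas [measurable]: "(\<lambda>x. ennreal (?p x)) \<in> borel_measurable ?R"
    unfolding p using measurable_restrict_space1[of "\<lambda>x. Q (actH (- h) x)" borel borel Xs] by simp
  have "emeasure (distr (density ?R (\<lambda>x. ennreal (?p x))) T t) B
      = emeasure (density ?R (\<lambda>x. ennreal (?p x))) (t -` B \<inter> space ?R)"
    by (subst emeasure_distr) auto
  also have "\<dots> = (\<integral>\<^sup>+x. ennreal (?p x) * indicator (t -` B \<inter> space ?R) x \<partial>?R)"
    using measurable_sets[OF t B] sets_R
    by (intro emeasure_density) (auto simp: space_restrict_space)
  also have "\<dots> = (\<integral>\<^sup>+x. ennreal (?p x) * indicator B (t x) * indicator Xs x \<partial>lam)"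
    by (subst nn_integral_lam_Xs) (auto intro!: nn_integral_cong simp: space_restrict_space indicator_def)
  also have "\<dots> = (\<integral>\<^sup>+x. QB (actH (- h) x) \<partial>lam)"
  proof (rule nn_integral_cong_AE, rule AE_mp[OF AE_Xs], intro AE_I2 impI)
    fix x assume x: "x \<in> Xs"
    have "t (?z (actH (- h) x)) = t x" if "actH (- h) x \<in> Xs"
      using t_G[OF that] t_H[OF x that] by (simp add: orbit_part_def)
    with x show "ennreal (?p x) * indicator B (t x) * indicator Xs x = QB (actH (- h) x)"
      by (simp add: p Q_def QB_def mult.commute indicator_def)
  qed
  \<comment> \<open>Moving \<open>h\<close> to the unit produces \<open>chiH h\<close>, which
    cancels the \<open>1 / chiH h\<close> contained in \<open>q\<close> at the end.\<close>
  also have "\<dots> = ennreal (chiH h) * (\<integral>\<^sup>+x. QB x \<partial>lam)"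
    by (rule nn_integral_actH_uminus) measurable
  also have "(\<integral>\<^sup>+x. QB x \<partial>lam) = (\<integral>\<^sup>+x. indicator B (t (?z x)) * q (r x, ?z x) \<partial>?R)"
    unfolding nn_integral_lam_Xs QB_def ..
  also have "\<dots> = (\<integral>\<^sup>+z. \<integral>\<^sup>+a. ennreal (chiG a) * (indicator B (t z) * q (a, z)) \<partial>muG \<partial>nuZ)"
    using nn_integral_decomposition[of "\<lambda>(a, z). indicator B (t z) * q (a, z)"] by simp
  \<comment> \<open>Since \<open>chiG (- g + a)\<close> equals \<open>chiG a / chiG g\<close>, the
    factor \<open>1 / chiG g\<close> is absorbed, and left invariance of \<open>muG\<close> removes
    \<open>g\<close>.\<close>
  also have "\<dots> = (\<integral>\<^sup>+z. ennreal (1 / chiH h) * (indicator B (t z) * fibre_mass f (s z)) \<partial>nuZ)"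
  proof (rule nn_integral_cong)
    fix z
    define F where "F a = ennreal (chiG a) * q (a, z)" for a
    have F: "F a = ennreal (1 / chiH h) * (ennreal (chiG (- g + a)) * ennreal (f ((- g + a) + s z)))" for a
    proof -
      have "chiG (- g + a) = chiG a / chiG g"
        using chiG_add[of g "- g + a"] chiG_pos[of g] by simp
      then show ?thesis
        using chiG_pos[of a] chiG_pos[of g] chiH_pos[of h] f_nonneg[of "- g + a + s z"]
        by (simp add: F_def q_def flip: ennreal_mult)
    qed
    have "(\<integral>\<^sup>+a. F a \<partial>muG)
        = ennreal (1 / chiH h) * (\<integral>\<^sup>+a. ennreal (chiG (- g + a)) * ennreal (f ((- g + a) + s z)) \<partial>muG)"
      unfolding F by (rule nn_integral_cmult) measurable
    also have "\<dots> = ennreal (1 / chiH h) * fibre_mass f (s z)"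
      unfolding fibre_mass_def
      by (subst G.nn_integral_add_left[of "\<lambda>a. ennreal (chiG a) * ennreal (f (a + s z))" "- g"]) auto
    finally show "(\<integral>\<^sup>+a. ennreal (chiG a) * (indicator B (t z) * q (a, z)) \<partial>muG)
        = ennreal (1 / chiH h) * (indicator B (t z) * fibre_mass f (s z))"
      by (auto simp: F_def indicator_def)
  qed
  also have "\<dots> = ennreal (1 / chiH h) * (\<integral>\<^sup>+z. indicator B (t z) * fibre_mass f (s z) \<partial>nuZ)"
    by (rule nn_integral_cmult) measurable
  finally show ?thesis
    using chiH_pos[of h] by (simp add: sampling_dist_def flip: mult.assoc ennreal_mult)
qed

end

theorem corollary3p4:
  fixes actH :: "'h::{topological_group_add, t2_space, second_countable_topology} \<Rightarrow> 'x::t2_space \<Rightarrow> 'x"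
    and actG :: "'g::{topological_group_add, t2_space, second_countable_topology} \<Rightarrow> 'x \<Rightarrow> 'x"
    and Xs :: "'x set" and lam :: "'x measure"
    and chiH :: "'h \<Rightarrow> real" and chiG :: "'g \<Rightarrow> real"
    and r :: "'x \<Rightarrow> 'g" and s :: "'x \<Rightarrow> 'g"
    and muG :: "'g measure" and nuZ :: "'x measure"
    and H0 :: "'h set" and G0 :: "'g set"
    and T :: "'t measure" and t :: "'x \<Rightarrow> 't"
    and h :: 'h and g :: 'g
    and f f' :: "'g \<Rightarrow> real"
  assumes model: "orbital_model actH actG Xs lam chiH chiG r s muG nuZ H0 G0"
    and measurable_t: "t \<in> restrict_space borel Xs \<rightarrow>\<^sub>M T"
    and invariant_G: "\<And>b x. x \<in> Xs \<Longrightarrow> t (actG b x) = t x"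
    and invariant_H: "\<And>a x. x \<in> Xs \<Longrightarrow> actH a x \<in> Xs \<Longrightarrow> t (actH a x) = t x"
    and f: "admissible actH actG Xs lam chiH chiG r s H0 G0 f"
    and f': "admissible actH actG Xs lam chiH chiG r s H0 G0 f'"
  shows "distr (sampling_dist actH actG Xs lam chiH chiG r s f h g) T t
       = distr (sampling_dist actH actG Xs lam chiH chiG r s f' h g) T t"
proof -
  interpret orbital_model actH actG Xs lam chiH chiG r s muG nuZ H0 G0
    by (fact model)
  show ?thesis
  proof (rule measure_eqI)
    fix B assume "B \<in> sets (distr (sampling_dist actH actG Xs lam chiH chiG r s f h g) T t)"
    then have B: "B \<in> sets T" by simp
    \<comment> \<open>In the formula for the distribution of \<open>t\<close>, \<open>f\<close>
      enters only through \<open>fibre_mass f\<close>.\<close>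
    have "fibre_mass f = fibre_mass f'"
      using f f' unfolding admissible_def by (intro fibre_mass_unique) auto
    then show "emeasure (distr (sampling_dist actH actG Xs lam chiH chiG r s f h g) T t) B
        = emeasure (distr (sampling_dist actH actG Xs lam chiH chiG r s f' h g) T t) B"
      using f f' unfolding admissible_def
      by (simp add: emeasure_distr_statistic[OF measurable_t invariant_G invariant_H _ _ B])
  qed simp
qed

end
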